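(* Let $\ell\ge0$, $c>0$, and define on $\mathrm{Mat}_{\ell+1}(\mathbb{R})$ the modified Feynman (imaginary Gaussian) density $$\widetilde{G}_W(g)=\Delta_W(g)\,(c\pi^{-1})^{\frac{\ell(\ell+1)}{4}}\,e^{-\imath\pi\,\mathrm{Tr}(g^{\top}g)} .$$ Then its Fourier transform, understood through the regularization described in the context, satisfies $$(\mathcal{F}\,\widetilde{G}_W)(g)=e^{-\frac{\imath\pi(\ell+1)^2}{4}}\;\overline{\widetilde{G}_W(g)}\qquad\text{for all } g\in\mathrm{Mat}_{\ell+1}(\mathbb{R}).$$
   Context: $\imath=\sqrt{-1}$. For a matrix $g$ of size $\ell+1$, $\Delta_W(g)=\sum_{I\subseteq\{1,\dots,\ell+1\}}\binom{\ell+1}{|I|}\Delta_I(g)$, where $\Delta_I(g)$ is the principal minor of $g$ with rows and columns in $I$, and $\Delta_\emptyset(g)=1$. The Fourier transform on $\mathrm{Mat}_{\ell+1}(\mathbb{R})$ is $$(\mathcal{F}f)(\tilde g)=\int_{\mathrm{Mat}_{\ell+1}(\mathbb{R})}dg\,e^{2\pi\imath\,\mathrm{Tr}(g^{\top}\tilde g)}f(g),\qquad dg=\prod_{i,j=1}^{\ell+1}dg_{ij}.$$ Since $\widetilde{G}_W$ is not integrable, $\mathcal{F}\widetilde{G}_W$ is defined as the pointwise limit $\lim_{\varepsilon\to0+}\mathcal{F}\widetilde{G}_W(\cdot|\varepsilon)$ with $$\widetilde{G}_W(g|\varepsilon)=\Delta_W(g)\,(c\pi^{-1})^{\frac{\ell(\ell+1)}{4}}\,e^{-(\varepsilon+\imath\pi)\mathrm{Tr}(g^{\top}g)},\qquad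 \varepsilon>0.$$ *)

theory Defs
  imports "HOL-Analysis.Analysis"
begin

text \<open>
  Square matrices of size \<open>\<ell> + 1\<close> are rendered as \<open>real ^ 'n ^ 'n\<close> with \<open>CARD('n) = \<ell> + 1\<close>;
  the index type \<open>'n\<close> plays the role of \<open>{1, \<dots>, \<ell> + 1}\<close>. The Lebesgue measure \<open>lborel\<close> on this
  Euclidean space is the product of the Lebesgue measures of the matrix entries.
\<close>

text \<open>
  The Leibniz formula of \<^const>\<open>det\<close>, restricted to the rows and columns in \<open>I\<close>. No order on \<open>I\<close>
  is needed, since a simultaneous reordering of rows and columns does not change the determinant.
\<close>
definition principal_minor :: "'n set \<Rightarrow> real ^ 'n ^ 'n \<Rightarrow> real" where
  "principal_minor I g =
     (\<Sum>p\<in>{p. p permutes I}. of_int (sign p) * (\<Prod>i\<in>I. g $ i $ p i))"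

lemma principal_minor_empty [simp]: "principal_minor {} g = 1"
  by (simp add: principal_minor_def)

lemma principal_minor_UNIV: "principal_minor UNIV g = det g"
  by (simp add: principal_minor_def det_def)

definition Delta_W :: "real ^ 'n ^ 'n \<Rightarrow> real" where
  "Delta_W g = (\<Sum>I\<in>(UNIV :: 'n set set). real (CARD('n) choose card I) * principal_minor I g)"

definition feynman_W :: "nat \<Rightarrow> real \<Rightarrow> real ^ 'n ^ 'n \<Rightarrow> complex" where
  "feynman_W l c g =
     complex_of_real (Delta_W g) * complex_of_real ((c / pi) powr (real l * (real l + 1) / 4)) *
     exp (- (\<i> * complex_of_real pi * complex_of_real (trace (transpose g ** g))))"

definition feynman_W_reg :: "nat \<Rightarrow> real \<Rightarrow> real \<Rightarrow> real ^ 'n ^ 'n \<Rightarrow> complex" where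
  "feynman_W_reg l c \<epsilon> g =
     complex_of_real (Delta_W g) * complex_of_real ((c / pi) powr (real l * (real l + 1) / 4)) *
     exp (- ((complex_of_real \<epsilon> + \<i> * complex_of_real pi) *
             complex_of_real (trace (transpose g ** g))))"

definition mat_fourier :: "(real ^ 'n ^ 'n \<Rightarrow> complex) \<Rightarrow> real ^ 'n ^ 'n \<Rightarrow> complex" where
  "mat_fourier f h =
     (LINT g|lborel. exp (2 * complex_of_real pi * \<i> * complex_of_real (trace (transpose g ** h))) * f g)"

text \<open>
  \<open>F\<close> is the Fourier transform of \<^const>\<open>feynman_W\<close> in the regularized sense: it is the pointwise
  limit of the Fourier transforms of the regularized densities. Integrability is required
  explicitly because the Bochner integral of a non-integrable function is \<open>0\<close> by convention.
\<close>
definition feynman_W_has_fourier ::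
    "nat \<Rightarrow> real \<Rightarrow> (real ^ 'n ^ 'n \<Rightarrow> complex) \<Rightarrow> bool" where
  "feynman_W_has_fourier l c F \<longleftrightarrow>
     (\<forall>\<epsilon>>0. integrable lborel (feynman_W_reg l c \<epsilon> :: real ^ 'n ^ 'n \<Rightarrow> complex)) \<and>
     (\<forall>g. ((\<lambda>\<epsilon>. mat_fourier (feynman_W_reg l c \<epsilon>) g) \<longlongrightarrow> F g) (at_right 0))"

end

theory Submission
  imports Defs "HOL-Probability.Probability" "HOL-Real_Asymp.Real_Asymp"
begin

text \<open>
  Each monomial of a principal minor contains every matrix entry to power at most one, so its
  product with the Gaussian factorizes over the entries, and the Fourier transform of
  \<open>exp (- a * tr (g\<^sup>T g))\<close> times the monomial involves only the one-dimensional integrals of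
  \<open>exp (2 * pi * i * x * y - a * x^2)\<close> with an extra factor \<open>1\<close> or \<open>x\<close>. The factor \<open>x\<close>
  becomes \<open>pi * i * y / a\<close>, without any contraction terms, and \<open>pi * i / a\<close> tends to \<open>1\<close> as
  \<open>a\<close> tends to \<open>i * pi\<close>; each of the \<open>(l + 1)^2\<close> integrals contributes the phase
  \<open>exp (- i * pi / 4)\<close>. The Gaussian integral for complex \<open>a\<close> is obtained from the
  characteristic function of the normal distribution at \<open>a = 1/2\<close> by a differential equation in
  \<open>a\<close> on the half-plane \<open>Re a > 0\<close>.
\<close>

section \<open>Differentiation under the integral sign\<close>

text \<open>On the convex ball the bound on \<open>f'\<close> makes every difference quotient at
  most \<open>w\<close> in norm, by the mean value inequality, so dominated convergence applies to
  the quotients.\<close>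

lemma has_field_derivative_integral_dominated:
  fixes f f' :: "complex \<Rightarrow> 'a \<Rightarrow> complex"
  assumes r: "r > 0"
    and int: "\<And>z. z \<in> ball z0 r \<Longrightarrow> integrable M (f z)"
    and deriv: "\<And>z x. z \<in> ball z0 r \<Longrightarrow> ((\<lambda>z. f z x) has_field_derivative f' z x) (at z)"
    and bound: "\<And>z x. z \<in> ball z0 r \<Longrightarrow> norm (f' z x) \<le> w x"
    and w: "integrable M w"
    and meas: "f' z0 \<in> borel_measurable M"
  shows "((\<lambda>z. LINT x|M. f z x) has_field_derivative (LINT x|M. f' z0 x)) (at z0)"
proof -
  define q where "q = (\<lambda>z x. (f z x - f z0 x) / (z - z0))"
  have z0: "z0 \<in> ball z0 r" using r by simp
  have q_bound: "norm (q z x) \<le> w x" if "z \<in> ball z0 r" "z \<noteq> z0" for z x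
  proof -
    have "norm (f z x - f z0 x) \<le> w x * norm (z - z0)"
      by (rule field_differentiable_bound[where S = "ball z0 r" and f' = "\<lambda>z. f' z x"])
         (use that z0 deriv bound in \<open>auto intro: has_field_derivative_at_within\<close>)
    then show ?thesis using that by (simp add: q_def norm_divide field_simps)
  qed
  have "((\<lambda>z. LINT x|M. q z x) \<longlongrightarrow> (LINT x|M. f' z0 x)) (at z0)"
    unfolding tendsto_at_iff_sequentially comp_def
  proof (intro allI impI)
    fix X :: "nat \<Rightarrow> complex"
    assume X: "\<forall>i. X i \<in> UNIV - {z0}" "X \<longlonglongrightarrow> z0"
    \<comment> \<open>The domination holds only inside the ball, so the sequence is shifted by
      \<open>N\<close> and the shift is undone after passing to the limit.\<close>
    have "eventually (\<lambda>n. X n \<in> ball z0 r) sequentially"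
      using X(2) z0 by (intro topological_tendstoD) auto
    then obtain N where N: "\<And>n. n \<ge> N \<Longrightarrow> X n \<in> ball z0 r"
      by (auto simp: eventually_sequentially)
    have "(\<lambda>n. LINT x|M. q (X (n + N)) x) \<longlonglongrightarrow> (LINT x|M. f' z0 x)"
    proof (rule integral_dominated_convergence[where w = w])
      show "q (X (n + N)) \<in> borel_measurable M" for n
        unfolding q_def using int[OF N[of "n + N"]] int[OF z0] by simp
      have "(\<lambda>n. q (X n) x) \<longlonglongrightarrow> f' z0 x" for x
      proof -
        have "((\<lambda>z. q z x) \<longlongrightarrow> f' z0 x) (at z0)"
          using deriv[OF z0, of x] by (simp add: has_field_derivative_iff q_def)
        then show ?thesis using X by (auto simp: tendsto_at_iff_sequentially comp_def)
      qed
      then show "AE x in M. (\<lambda>n. q (X (n + N)) x) \<longlonglongrightarrow> f' z0 x"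
        by (intro AE_I2 LIMSEQ_ignore_initial_segment)
      show "AE x in M. norm (q (X (n + N)) x) \<le> w x" for n
        using q_bound[OF N[of "n + N"]] X(1) by auto
    qed (use meas w in auto)
    then show "(\<lambda>n. LINT x|M. q (X n) x) \<longlonglongrightarrow> (LINT x|M. f' z0 x)"
      by (rule LIMSEQ_offset)
  qed
  moreover have "eventually (\<lambda>z. (LINT x|M. q z x) = ((LINT x|M. f z x) - (LINT x|M. f z0 x)) / (z - z0)) (at z0)"
  proof -
    have "eventually (\<lambda>z. z \<in> ball z0 r) (at z0)"
      using z0 by (intro eventually_at_in_open') auto
    then show ?thesis
      by eventually_elim (use int z0 in \<open>simp add: q_def\<close>)
  qed
  ultimately show ?thesis
    unfolding has_field_derivative_iff by (rule Lim_transform_eventually)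
qed

section \<open>Gaussian waves in one variable: integrability, decay and moments\<close>

text \<open>One matrix entry's share of the Fourier kernel times the Gaussian: \<open>x\<close> is
  the entry of the integration variable, \<open>y\<close> that of the frequency.\<close>

definition gauss_wave :: "complex \<Rightarrow> real \<Rightarrow> real \<Rightarrow> complex" where
  "gauss_wave a y x = exp (2 * of_real pi * \<i> * of_real (x * y) - a * of_real (x\<^sup>2))"

lemma norm_gauss_wave: "norm (gauss_wave a y x) = exp (- Re a * x\<^sup>2)"
  by (simp add: gauss_wave_def)

lemma continuous_on_gauss_wave [continuous_intros]: "continuous_on A (gauss_wave a y)"
  unfolding gauss_wave_def by (intro continuous_intros)

lemma gauss_wave_measurable [measurable]: "gauss_wave a y \<in> borel_measurable borel"
  by (intro borel_measurable_continuous_onI continuous_intros)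

lemma integrable_power_gauss:
  fixes r :: real
  assumes "r > 0"
  shows "integrable lborel (\<lambda>x. \<bar>x\<bar> ^ k * exp (- r * x\<^sup>2))"
proof -
  \<comment> \<open>With this standard deviation the normal density has exponent
    \<open>- r * x^2\<close>, so the claim reduces to its absolute moments.\<close>
  define s where "s = 1 / sqrt (2 * r)"
  have s: "s > 0" "2 * s\<^sup>2 = 1 / r"
    using assms by (simp_all add: s_def power_divide field_simps)
  have "integrable lborel (\<lambda>x. sqrt (2 * pi * s\<^sup>2) * (normal_density 0 s x * \<bar>x - 0\<bar> ^ k))"
    using integrable_normal_moment_abs[of s 0 k] s by simp
  also have "(\<lambda>x. sqrt (2 * pi * s\<^sup>2) * (normal_density 0 s x * \<bar>x - 0\<bar> ^ k)) =
      (\<lambda>x. \<bar>x\<bar> ^ k * exp (- r * x\<^sup>2))"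
    using s assms by (simp add: normal_density_def fun_eq_iff field_simps)
  finally show ?thesis .
qed

lemma integrable_power_gauss_wave:
  assumes "Re a > 0"
  shows "integrable lborel (\<lambda>x. of_real x ^ k * gauss_wave a y x)"
proof (rule Bochner_Integration.integrable_bound[OF integrable_power_gauss[OF assms, of k]])
  show "(\<lambda>x. of_real x ^ k * gauss_wave a y x) \<in> borel_measurable lborel"
    by measurable
qed (simp add: norm_mult norm_power norm_gauss_wave)

lemma gauss_wave_deriv:
  "(gauss_wave a y has_vector_derivative
     (2 * of_real pi * \<i> * of_real y - 2 * a * of_real x) * gauss_wave a y x) (at x)"
proof -
  \<comment> \<open>The real variable is made complex so that the complex differentiation rules
    apply; the result is then restricted to the real line.\<close>
  define F where "F = (\<lambda>z. exp (2 * of_real pi * \<i> * (z * of_real y) - a * z\<^sup>2))"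
  have "(F has_field_derivative
     (2 * of_real pi * \<i> * of_real y - 2 * a * of_real x) * F (of_real x)) (at (of_real x))"
    unfolding F_def by (auto intro!: derivative_eq_intros)
  from has_vector_derivative_real_field[OF this] show ?thesis
    by (simp add: F_def gauss_wave_def[abs_def])
qed

text \<open>Supplies the vanishing boundary terms for the first moment (\<open>k = 0\<close>) and
  the second moment (\<open>k = 1\<close>).\<close>

lemma gauss_wave_decay:
  assumes "Re a > 0" "k \<le> 1" "F = at_top \<or> F = at_bot"
  shows "((\<lambda>x. of_real x ^ k * gauss_wave a y x) \<longlongrightarrow> 0) F"
proof -
  define r where "r = Re a"
  have r: "r > 0" using assms by (simp add: r_def)
  have "((\<lambda>x. exp (- r * x\<^sup>2)) \<longlongrightarrow> 0) at_top" "((\<lambda>x. exp (- r * x\<^sup>2)) \<longlongrightarrow> 0) at_bot"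
    "((\<lambda>x. \<bar>x\<bar> * exp (- r * x\<^sup>2)) \<longlongrightarrow> 0) at_top" "((\<lambda>x. \<bar>x\<bar> * exp (- r * x\<^sup>2)) \<longlongrightarrow> 0) at_bot"
    using r by real_asymp+
  moreover have "k = 0 \<or> k = 1" using assms by auto
  ultimately have "((\<lambda>x. \<bar>x\<bar> ^ k * exp (- r * x\<^sup>2)) \<longlongrightarrow> 0) F"
    using assms(3) by auto
  then show ?thesis
    by (subst tendsto_norm_zero_iff[symmetric]) (simp add: norm_mult norm_power norm_gauss_wave r_def)
qed

text \<open>The fundamental theorem of calculus on the whole line with zero boundary values. It
  takes the place of integration by parts in the moment identities.\<close>

lemma integral_derivative_eq_0:
  fixes F f :: "real \<Rightarrow> complex"
  assumes "\<And>x. (F has_vector_derivative f x) (at x)" "continuous_on UNIV f" "integrable lborel f"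
    and "(F \<longlongrightarrow> 0) at_bot" "(F \<longlongrightarrow> 0) at_top"
  shows "(LINT x|lborel. f x) = 0"
proof -
  have "(LBINT x=-\<infinity>..\<infinity>. f x) = 0 - 0"
    by (rule interval_integral_FTC_integrable[where F = F])
       (use assms in \<open>auto simp: ereal_tendsto_simps set_integrable_def einterval_def
          continuous_on_eq_continuous_at\<close>)
  then show ?thesis
    by (simp add: interval_lebesgue_integral_def einterval_def set_lebesgue_integral_def)
qed

text \<open>The derivative of the wave in \<open>x\<close> integrates to 0. It is a combination of
  the wave and \<open>x\<close> times the wave, so this is a linear equation for the first
  moment.\<close>

lemma gauss_wave_first_moment:
  assumes a: "Re a > 0"
  shows "(LINT x|lborel. of_real x * gauss_wave a y x) =
    of_real pi * \<i> * of_real y / a * (LINT x|lborel. gauss_wave a y x)"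
proof -
  note int = integrable_power_gauss_wave[OF a, of 0 y, simplified] integrable_power_gauss_wave[OF a, of 1 y, simplified]
  have "(LINT x|lborel. (2 * of_real pi * \<i> * of_real y - 2 * a * of_real x) * gauss_wave a y x) = 0"
  proof (rule integral_derivative_eq_0[where F = "gauss_wave a y"])
    show "integrable lborel (\<lambda>x. (2 * of_real pi * \<i> * of_real y - 2 * a * of_real x) * gauss_wave a y x)"
      unfolding left_diff_distrib mult.assoc using int by simp
  qed (use gauss_wave_deriv gauss_wave_decay[OF a, of 0] in \<open>auto intro!: continuous_intros\<close>)
  then have "2 * of_real pi * \<i> * of_real y * (LINT x|lborel. gauss_wave a y x)
      - 2 * a * (LINT x|lborel. of_real x * gauss_wave a y x) = 0"
    unfolding left_diff_distrib mult.assoc using int by simp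
  then show ?thesis using a by (auto simp: field_simps)
qed

text \<open>The same argument for the derivative of \<open>x\<close> times the wave relates the
  moments of order 0, 1 and 2. The resulting factor is the coefficient of the differential equation
  in \<open>a\<close>.\<close>

lemma gauss_wave_second_moment:
  assumes a: "Re a > 0"
  shows "(LINT x|lborel. of_real x ^ 2 * gauss_wave a y x) =
    (1 / (2 * a) - (of_real (pi * y) / a)\<^sup>2) * (LINT x|lborel. gauss_wave a y x)"
proof -
  note int = integrable_power_gauss_wave[OF a, of 0 y, simplified] integrable_power_gauss_wave[OF a, of 1 y, simplified]
     integrable_power_gauss_wave[OF a, of 2 y]
  define f where "f = (\<lambda>x. gauss_wave a y x + 2 * of_real pi * \<i> * of_real y * (of_real x * gauss_wave a y x)
     - 2 * a * (of_real x ^ 2 * gauss_wave a y x))"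
  have "(LINT x|lborel. f x) = 0"
  proof (rule integral_derivative_eq_0[where F = "\<lambda>x. of_real x * gauss_wave a y x"])
    show "((\<lambda>x. of_real x * gauss_wave a y x) has_vector_derivative f x) (at x)" for x
      unfolding f_def
      by (rule has_vector_derivative_eq_rhs)
         (rule derivative_intros gauss_wave_deriv | simp add: algebra_simps power2_eq_square)+
    show "integrable lborel f" unfolding f_def using int by simp
  qed (use gauss_wave_decay[OF a, of 1] in \<open>auto intro!: continuous_intros simp: f_def\<close>)
  then have "(LINT x|lborel. gauss_wave a y x)
      + 2 * of_real pi * \<i> * of_real y * (LINT x|lborel. of_real x * gauss_wave a y x)
      - 2 * a * (LINT x|lborel. of_real x ^ 2 * gauss_wave a y x) = 0"
    unfolding f_def using int by simp
  moreover have "a \<noteq> 0" using a by auto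
  ultimately show ?thesis
    unfolding gauss_wave_first_moment[OF a] by (simp add: field_simps power2_eq_square)
qed

section \<open>Closed form of the one-dimensional Gaussian integral\<close>

text \<open>At \<open>a = 1/2\<close> the wave is a multiple of the standard normal density times a
  character, so its integral is the characteristic function at \<open>2 * pi * y\<close>. This is
  the initial value for the differential equation.\<close>

lemma gauss_wave_integral_half:
  "(LINT x|lborel. gauss_wave (1 / 2) y x) =
     of_real (sqrt (2 * pi)) * exp (- 2 * (of_real (pi * y))\<^sup>2)"
proof -
  have wave: "gauss_wave (1 / 2) y x = of_real (sqrt (2 * pi)) *
      (std_normal_density x *\<^sub>R exp (\<i> * of_real (2 * pi * y * x)))" for x
  proof -
    have "gauss_wave (1 / 2) y x = exp (of_real (- x\<^sup>2 / 2)) * exp (\<i> * of_real (2 * pi * y * x))"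
      unfolding gauss_wave_def exp_add[symmetric] by (simp add: algebra_simps)
    then show ?thesis
      unfolding exp_of_real by (simp add: std_normal_density_def scaleR_conv_of_real)
  qed
  have "(LINT x|lborel. gauss_wave (1 / 2) y x) =
      (LINT x|lborel. of_real (sqrt (2 * pi)) *
         (std_normal_density x *\<^sub>R exp (\<i> * of_real (2 * pi * y * x))))"
    by (simp only: wave)
  also have "\<dots> = of_real (sqrt (2 * pi)) * char std_normal_distribution (2 * pi * y)"
    by (simp add: char_def integral_density del: mult_scaleR_right)
  also have "\<dots> = of_real (sqrt (2 * pi)) * exp (- 2 * (of_real (pi * y))\<^sup>2)"
    by (simp add: char_std_normal_distribution exp_of_real[symmetric] power_mult_distrib)
  finally show ?thesis .
qed

lemma gauss_wave_integral_has_field_derivative: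
  assumes a: "Re a > 0"
  shows "((\<lambda>a. LINT x|lborel. gauss_wave a y x) has_field_derivative
     - (LINT x|lborel. of_real x ^ 2 * gauss_wave a y x)) (at a)"
proof -
  \<comment> \<open>Half the distance to the imaginary axis: on the ball \<open>Re z\<close> stays
    at least \<open>r\<close>, which gives one dominating function for all \<open>z\<close>.\<close>
  define r where "r = Re a / 2"
  have r: "r > 0" using a by (simp add: r_def)
  have ball: "Re z \<ge> r" if "z \<in> ball a r" for z
    using that abs_Re_le_cmod[of "a - z"] by (auto simp: dist_norm r_def)
  have "((\<lambda>a. LINT x|lborel. gauss_wave a y x) has_field_derivative
     (LINT x|lborel. - (of_real x ^ 2 * gauss_wave a y x))) (at a)"
  proof (rule has_field_derivative_integral_dominated[where r = r and w = "\<lambda>x. \<bar>x\<bar>\<^sup>2 * exp (- r * x\<^sup>2)"])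
    show "integrable lborel (gauss_wave z y)" if "z \<in> ball a r" for z
      using integrable_power_gauss_wave[of z 0 y] ball[OF that] r by simp
    show "((\<lambda>z. gauss_wave z y x) has_field_derivative - (of_real x ^ 2 * gauss_wave z y x)) (at z)" for z x
      unfolding gauss_wave_def by (auto intro!: derivative_eq_intros)
    show "norm (- (of_real x ^ 2 * gauss_wave z y x)) \<le> \<bar>x\<bar>\<^sup>2 * exp (- r * x\<^sup>2)" if "z \<in> ball a r" for z x
      using ball[OF that]
      by (auto simp: norm_mult norm_power norm_gauss_wave intro!: mult_left_mono mult_right_mono)
    show "integrable lborel (\<lambda>x. \<bar>x\<bar>\<^sup>2 * exp (- r * x\<^sup>2))"
      by (rule integrable_power_gauss[OF r])
    show "(\<lambda>x. - (of_real x ^ 2 * gauss_wave a y x)) \<in> borel_measurable lborel"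
      by measurable
  qed (rule r)
  then show ?thesis by simp
qed

lemma gauss_wave_integral:
  assumes a: "Re a > 0"
  shows "(LINT x|lborel. gauss_wave a y x) =
    of_real (sqrt pi) / csqrt a * exp (- (of_real (pi * y))\<^sup>2 / a)"
proof -
  define G where "G = (\<lambda>a. LINT x|lborel. gauss_wave a y x)"
  define p where "p = (complex_of_real (pi * y))\<^sup>2"
  \<comment> \<open>\<open>G\<close> divided by the expected solution, up to a constant factor; it
    remains to see that the quotient is constant on the half-plane.\<close>
  define H where "H = (\<lambda>a. csqrt a * (exp (p / a) * G a))"
  have "\<exists>C. \<forall>a\<in>{a. Re a > 0}. H a = C"
  proof (rule has_field_derivative_zero_constant)
    show "convex {a. Re a > 0}" by (rule convex_halfspace_Re_gt)
    fix a assume "a \<in> {a. Re a > 0}"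
    then have a: "Re a > 0" by simp
    then have nz: "a \<noteq> 0" "csqrt a \<noteq> 0" by auto
    have G': "(G has_field_derivative - ((1 / (2 * a) - p / a\<^sup>2) * G a)) (at a)"
      using gauss_wave_integral_has_field_derivative[OF a, of y]
      by (simp add: G_def p_def gauss_wave_second_moment[OF a] power_divide)
    \<comment> \<open>The right half-plane avoids the branch cut, so \<open>csqrt\<close> is
      differentiable there.\<close>
    have "a \<notin> \<real>\<^sub>\<le>\<^sub>0" using a by (auto simp: complex_nonpos_Reals_iff)
    then have "(H has_field_derivative
        (1 / (2 * csqrt a) * (exp (p / a) * G a) + csqrt a * (- p / a\<^sup>2 * exp (p / a) * G a
         + exp (p / a) * - ((1 / (2 * a) - p / a\<^sup>2) * G a)))) (at a)"
      unfolding H_def using nz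
      by (auto intro!: derivative_eq_intros G' simp: power2_eq_square)
    also have "1 / (2 * csqrt a) * (exp (p / a) * G a) + csqrt a * (- p / a\<^sup>2 * exp (p / a) * G a
         + exp (p / a) * - ((1 / (2 * a) - p / a\<^sup>2) * G a)) =
        (1 / csqrt a - csqrt a / a) * (exp (p / a) * G a / 2)"
      using nz by (simp add: field_simps)
    \<comment> \<open>The terms with \<open>p\<close> have cancelled already; the rest vanishes
      because \<open>csqrt a\<close> squares to \<open>a\<close>.\<close>
    also have "1 / csqrt a - csqrt a / a = 0"
      using nz by (simp add: field_simps flip: power2_eq_square)
    finally show "(H has_field_derivative 0) (at a within {a. Re a > 0})"
      by (simp add: has_field_derivative_at_within)
  qed
  then have "H a = H (1 / 2)" using a by auto
  \<comment> \<open>At \<open>1/2\<close> the factor \<open>exp (p / a)\<close> is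
    \<open>exp (2 * p)\<close> and cancels the exponential of the initial value.\<close>
  also have "\<dots> = csqrt (1 / 2) * of_real (sqrt (2 * pi))"
    by (simp add: H_def G_def gauss_wave_integral_half p_def exp_minus mult_ac)
  also have "csqrt (1 / 2) = of_real (sqrt (1 / 2))"
    by (subst of_real_sqrt) auto
  also have "of_real (sqrt (1 / 2)) * of_real (sqrt (2 * pi)) = complex_of_real (sqrt pi)"
    by (simp add: real_sqrt_mult real_sqrt_divide)
  finally have "csqrt a * (exp (p / a) * G a) = of_real (sqrt pi)" by (simp add: H_def)
  moreover have "csqrt a \<noteq> 0" using a by auto
  ultimately have "G a = of_real (sqrt pi) / csqrt a * exp (- (p / a))"
    by (simp add: exp_minus field_simps)
  then show ?thesis by (simp add: G_def p_def)
qed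

section \<open>Integrals of products over matrix entries\<close>

text \<open>Fubini: \<open>lborel\<close> is the image of the product of one-dimensional Lebesgue
  measures under the coordinate map of \<open>Basis\<close>.\<close>

lemma
  fixes f :: "'a::euclidean_space \<Rightarrow> real \<Rightarrow> complex"
  assumes "\<And>b. b \<in> Basis \<Longrightarrow> integrable lborel (f b)"
  shows integrable_lborel_prod: "integrable lborel (\<lambda>x::'a. \<Prod>b\<in>Basis. f b (x \<bullet> b))"
    and integral_lborel_prod:
      "(LINT x|(lborel :: 'a measure). (\<Prod>b\<in>Basis. f b (x \<bullet> b))) = (\<Prod>b\<in>Basis. LINT t|lborel. f b t)"
proof -
  interpret product_sigma_finite "\<lambda>_::'a. lborel :: real measure" ..
  have f [measurable]: "b \<in> Basis \<Longrightarrow> f b \<in> borel_measurable borel" for b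
    using assms[of b] by auto
  have m: "(\<lambda>x. \<Prod>b\<in>Basis. f b (x \<bullet> b)) \<in> borel_measurable (borel :: 'a measure)"
    by measurable
  have s: "(\<Prod>b\<in>Basis. f b ((\<Sum>b'\<in>Basis. x b' *\<^sub>R b') \<bullet> b)) = (\<Prod>b\<in>Basis. f b (x b))" for x
    by (intro prod.cong) auto
  show "integrable lborel (\<lambda>x::'a. \<Prod>b\<in>Basis. f b (x \<bullet> b))"
    by (subst lborel_eq, subst integrable_distr_eq)
       (use m assms in \<open>auto simp: s intro!: product_integrable_prod\<close>)
  show "(LINT x|(lborel :: 'a measure). (\<Prod>b\<in>Basis. f b (x \<bullet> b))) = (\<Prod>b\<in>Basis. LINT t|lborel. f b t)"
    by (subst lborel_eq, subst integral_distr)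
       (use m assms in \<open>auto simp: s intro!: product_integral_prod\<close>)
qed

lemma
  fixes f :: "'n::finite \<Rightarrow> 'm::finite \<Rightarrow> real \<Rightarrow> complex"
  assumes "\<And>i j. integrable lborel (f i j)"
  shows integrable_matrix_prod:
      "integrable lborel (\<lambda>g::real ^ 'm ^ 'n. \<Prod>i\<in>UNIV. \<Prod>j\<in>UNIV. f i j (g $ i $ j))"
    and integral_matrix_prod:
      "(LINT g|(lborel :: (real ^ 'm ^ 'n) measure). (\<Prod>i\<in>UNIV. \<Prod>j\<in>UNIV. f i j (g $ i $ j))) =
        (\<Prod>i\<in>UNIV. \<Prod>j\<in>UNIV. LINT t|lborel. f i j t)"
proof -
  \<comment> \<open>The matrix units: they enumerate \<open>Basis\<close> without repetition, and
    the inner product with \<open>E (i, j)\<close> reads off the entry at \<open>i\<close>,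
    \<open>j\<close>.\<close>
  define E :: "'n \<times> 'm \<Rightarrow> real ^ 'm ^ 'n" where "E = (\<lambda>(i, j). axis i (axis j 1))"
  have inj: "inj E" by (auto simp: inj_on_def E_def axis_eq_axis)
  have Basis: "Basis = range E" by (auto simp: E_def Basis_vec_def image_iff)
  define F where "F = (\<lambda>b. case inv E b of (i, j) \<Rightarrow> f i j)"
  have prod_Basis: "(\<Prod>b\<in>Basis. P b) = (\<Prod>i\<in>UNIV. \<Prod>j\<in>UNIV. P (E (i, j)))"
    for P :: "real ^ 'm ^ 'n \<Rightarrow> complex"
    by (simp add: Basis prod.reindex[OF inj] prod.cartesian_product)
  have F: "F (E (i, j)) = f i j" for i j by (simp add: F_def inj)
  have int: "integrable lborel (F b)" for b
    using assms by (simp add: F_def case_prod_unfold)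
  have eq: "(\<Prod>b\<in>Basis. F b (g \<bullet> b)) = (\<Prod>i\<in>UNIV. \<Prod>j\<in>UNIV. f i j (g $ i $ j))" for g
    unfolding prod_Basis F by (simp add: E_def inner_axis)
  show "integrable lborel (\<lambda>g::real ^ 'm ^ 'n. \<Prod>i\<in>UNIV. \<Prod>j\<in>UNIV. f i j (g $ i $ j))"
    using integrable_lborel_prod[of F] int unfolding eq by simp
  show "(LINT g|(lborel :: (real ^ 'm ^ 'n) measure). (\<Prod>i\<in>UNIV. \<Prod>j\<in>UNIV. f i j (g $ i $ j))) =
        (\<Prod>i\<in>UNIV. \<Prod>j\<in>UNIV. LINT t|lborel. f i j t)"
    using integral_lborel_prod[of F] int unfolding eq prod_Basis F by simp
qed

lemma trace_transpose_mult:
  fixes g h :: "real ^ 'n ^ 'n"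
  shows "trace (transpose g ** h) = (\<Sum>i\<in>UNIV. \<Sum>j\<in>UNIV. g $ i $ j * h $ i $ j)"
  unfolding trace_def matrix_matrix_mult_def transpose_def
  by (simp, rule sum.swap)

text \<open>Rewrites a monomial along the graph of \<open>p\<close> over \<open>I\<close> as a
  product over all entries with exponents 0 or 1, the shape needed to factorize the
  integral.\<close>

lemma prod_graph_power:
  fixes F :: "'n::finite \<Rightarrow> 'n \<Rightarrow> 'a::comm_semiring_1"
  shows "(\<Prod>i\<in>UNIV. \<Prod>j\<in>UNIV. F i j ^ of_bool (i \<in> I \<and> j = p i)) = (\<Prod>i\<in>I. F i (p i))"
proof -
  have "(\<Prod>j\<in>UNIV. F i j ^ of_bool (i \<in> I \<and> j = p i)) = (if i \<in> I then F i (p i) else 1)" for i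
  proof -
    have "(\<Prod>j\<in>UNIV. F i j ^ of_bool (i \<in> I \<and> j = p i)) =
        (\<Prod>j\<in>UNIV. if j = p i then (if i \<in> I then F i j else 1) else 1)"
      by (rule prod.cong) auto
    then show ?thesis by (simp add: prod.delta)
  qed
  then show ?thesis by (simp add: prod.If_cases)
qed

section \<open>Gaussian integrals of principal minors\<close>

definition mat_wave :: "complex \<Rightarrow> real ^ 'n ^ 'n \<Rightarrow> real ^ 'n ^ 'n \<Rightarrow> complex" where
  "mat_wave a h g = exp (2 * of_real pi * \<i> * of_real (trace (transpose g ** h))
     - a * of_real (trace (transpose g ** g)))"

lemma mat_wave_eq_prod:
  "mat_wave a h g = (\<Prod>i\<in>UNIV. \<Prod>j\<in>UNIV. gauss_wave a (h $ i $ j) (g $ i $ j))"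
  unfolding mat_wave_def gauss_wave_def trace_transpose_mult
  by (simp add: exp_sum[symmetric] sum_subtractf sum_distrib_left power2_eq_square)

text \<open>The value of the integral of \<open>mat_wave a h\<close> for \<open>Re a > 0\<close>. As
  a formula it also makes sense at \<open>a = i * pi\<close>, where the limit will be read
  off.\<close>

definition mat_wave_int :: "complex \<Rightarrow> real ^ 'n ^ 'n \<Rightarrow> complex" where
  "mat_wave_int a h = (of_real (sqrt pi) / csqrt a) ^ (CARD('n)\<^sup>2) *
     exp (- of_real (pi\<^sup>2 * trace (transpose h ** h)) / a)"

lemma prod_gauss_wave_integral:
  fixes h :: "real ^ 'n ^ 'n"
  assumes "Re a > 0"
  shows "(\<Prod>i\<in>UNIV. \<Prod>j\<in>UNIV. LINT t|lborel. gauss_wave a (h $ i $ j) t) = mat_wave_int a h"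
proof -
  define s where "s = of_real (sqrt pi) / csqrt a"
  have "(\<Prod>i\<in>UNIV. \<Prod>j\<in>UNIV. s * exp (- (of_real (pi * h $ i $ j))\<^sup>2 / a)) =
      s ^ (CARD('n)\<^sup>2) * exp (\<Sum>i\<in>UNIV. \<Sum>j\<in>UNIV. - (of_real (pi * h $ i $ j))\<^sup>2 / a)"
    by (simp add: prod.distrib exp_sum power2_eq_square power_mult)
  also have "(\<Sum>i\<in>UNIV. \<Sum>j\<in>UNIV. - (of_real (pi * h $ i $ j))\<^sup>2 / a) =
      - of_real (pi\<^sup>2 * trace (transpose h ** h)) / a"
    by (simp add: trace_transpose_mult sum_distrib_left sum_negf sum_divide_distrib
        power2_eq_square mult_ac)
  finally show ?thesis
    by (simp add: mat_wave_int_def gauss_wave_integral[OF assms] s_def)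
qed

lemma
  fixes h :: "real ^ 'n ^ 'n"
  assumes a: "Re a > 0"
  shows integrable_monomial_mat_wave:
      "integrable lborel (\<lambda>g. (\<Prod>i\<in>I. of_real (g $ i $ p i)) * mat_wave a h g)"
    and integral_monomial_mat_wave:
      "(LINT g|lborel. (\<Prod>i\<in>I. of_real (g $ i $ p i)) * mat_wave a h g) =
        (of_real pi * \<i> / a) ^ card I * (\<Prod>i\<in>I. of_real (h $ i $ p i)) * mat_wave_int a h"
proof -
  define e :: "'n \<Rightarrow> 'n \<Rightarrow> nat" where "e = (\<lambda>i j. of_bool (i \<in> I \<and> j = p i))"
  define f where "f = (\<lambda>i j t. of_real t ^ e i j * gauss_wave a (h $ i $ j) t)"
  have f: "integrable lborel (f i j)" for i j
    unfolding f_def by (rule integrable_power_gauss_wave[OF a])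
  have eq: "(\<Prod>i\<in>I. of_real (g $ i $ p i)) * mat_wave a h g =
      (\<Prod>i\<in>UNIV. \<Prod>j\<in>UNIV. f i j (g $ i $ j))" for g :: "real ^ 'n ^ 'n"
    by (simp add: f_def prod.distrib e_def prod_graph_power mat_wave_eq_prod)
  \<comment> \<open>Since \<open>e i j\<close> is 0 or 1, the first moment is the only one that
    enters.\<close>
  have "(LINT t|lborel. f i j t) = (of_real pi * \<i> / a * of_real (h $ i $ j)) ^ e i j *
      (LINT t|lborel. gauss_wave a (h $ i $ j) t)" for i j
    using gauss_wave_first_moment[OF a, of "h $ i $ j"] by (auto simp: f_def e_def)
  then have "(\<Prod>i\<in>UNIV. \<Prod>j\<in>UNIV. LINT t|lborel. f i j t) =
      (\<Prod>i\<in>I. of_real pi * \<i> / a * of_real (h $ i $ p i)) * mat_wave_int a h"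
    by (simp add: prod.distrib e_def prod_graph_power prod_gauss_wave_integral[OF a]
        del: times_divide_eq_left)
  then show "(LINT g|lborel. (\<Prod>i\<in>I. of_real (g $ i $ p i)) * mat_wave a h g) =
        (of_real pi * \<i> / a) ^ card I * (\<Prod>i\<in>I. of_real (h $ i $ p i)) * mat_wave_int a h"
    by (simp add: eq integral_matrix_prod[OF f] prod.distrib del: times_divide_eq_left)
  show "integrable lborel (\<lambda>g. (\<Prod>i\<in>I. of_real (g $ i $ p i)) * mat_wave a h g)"
    unfolding eq by (rule integrable_matrix_prod[OF f])
qed

lemma principal_minor_mult_complex:
  "of_real (principal_minor I g) * z =
    (\<Sum>p | p permutes I. of_int (sign p) * ((\<Prod>i\<in>I. of_real (g $ i $ p i)) * z))"
  by (simp add: principal_minor_def sum_distrib_right mult.assoc)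

text \<open>All Leibniz terms of the minor have the same degree \<open>card I\<close>, hence acquire
  the same factor, and the minor is reproduced at \<open>h\<close>.\<close>

lemma
  fixes h :: "real ^ 'n ^ 'n"
  assumes a: "Re a > 0"
  shows integrable_principal_minor_mat_wave:
      "integrable lborel (\<lambda>g. of_real (principal_minor I g) * mat_wave a h g)"
    and integral_principal_minor_mat_wave:
      "(LINT g|lborel. of_real (principal_minor I g) * mat_wave a h g) =
        (of_real pi * \<i> / a) ^ card I * (of_real (principal_minor I h) * mat_wave_int a h)"
  unfolding principal_minor_mult_complex
  by (simp_all add: integrable_monomial_mat_wave[OF a] integral_monomial_mat_wave[OF a]
      sum_distrib_left) (simp add: mult_ac)

text \<open>By homogeneity of the minors this is \<open>Delta_W\<close> at \<open>t * h\<close>,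
  extended to complex \<open>t\<close>; \<open>t = 1\<close> gives back
  \<open>Delta_W h\<close>.\<close>

definition Delta_W_scaled :: "complex \<Rightarrow> real ^ 'n ^ 'n \<Rightarrow> complex" where
  "Delta_W_scaled t h = (\<Sum>I\<in>(UNIV :: 'n set set).
     of_nat (CARD('n) choose card I) * (t ^ card I * of_real (principal_minor I h)))"

lemma
  fixes h :: "real ^ 'n ^ 'n"
  assumes a: "Re a > 0"
  shows integrable_Delta_W_mat_wave:
      "integrable lborel (\<lambda>g. of_real (Delta_W g) * mat_wave a h g)"
    and integral_Delta_W_mat_wave:
      "(LINT g|lborel. of_real (Delta_W g) * mat_wave a h g) =
        Delta_W_scaled (of_real pi * \<i> / a) h * mat_wave_int a h"
proof -
  have eq: "of_real (Delta_W g) * mat_wave a h g = (\<Sum>I\<in>UNIV. of_nat (CARD('n) choose card I) *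
      (of_real (principal_minor I g) * mat_wave a h g))" for g :: "real ^ 'n ^ 'n"
    by (simp add: Delta_W_def sum_distrib_right mult.assoc)
  show "integrable lborel (\<lambda>g. of_real (Delta_W g) * mat_wave a h g)"
    unfolding eq by (simp add: integrable_principal_minor_mat_wave[OF a])
  show "(LINT g|lborel. of_real (Delta_W g) * mat_wave a h g) =
      Delta_W_scaled (of_real pi * \<i> / a) h * mat_wave_int a h"
    unfolding eq
    by (simp add: integrable_principal_minor_mat_wave[OF a] integral_principal_minor_mat_wave[OF a]
        Delta_W_scaled_def sum_distrib_right mult.assoc)
qed

section \<open>The limit at the imaginary axis\<close>

text \<open>Squaring gives \<open>i * pi\<close>, and the positive real part selects the principal
  root. This is the source of the phase \<open>exp (- i * pi / 4)\<close> of each entry.\<close>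

lemma csqrt_ii_pi: "csqrt (\<i> * of_real pi) = of_real (sqrt pi) * exp (\<i> * of_real pi / 4)"
proof (rule csqrt_unique)
  have "exp (\<i> * of_real pi / 4) ^ 2 = exp (\<i> * of_real (pi / 2))"
    by (simp flip: exp_of_nat_mult)
  also have "\<dots> = \<i>" unfolding cis_conv_exp[symmetric] by simp
  finally have "exp (\<i> * of_real pi / 4) ^ 2 = \<i>" .
  then show "(of_real (sqrt pi) * exp (\<i> * of_real pi / 4))\<^sup>2 = \<i> * of_real pi"
    by (simp add: power_mult_distrib flip: of_real_power)
  have "Re (exp (\<i> * of_real pi / 4)) = cos (pi / 4)" by (simp add: Re_exp)
  also have "\<dots> > 0" by (simp add: cos_45)
  finally have "0 < Re (exp (\<i> * of_real pi / 4))" .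
  then show "0 < Re (of_real (sqrt pi) * exp (\<i> * of_real pi / 4)) \<or>
      Re (of_real (sqrt pi) * exp (\<i> * of_real pi / 4)) = 0 \<and>
      0 \<le> Im (of_real (sqrt pi) * exp (\<i> * of_real pi / 4))"
    by simp
qed

theorem proposition6p1:
  fixes l :: nat and c :: real
  assumes "CARD('n::finite) = l + 1" and "c > 0"
  shows "feynman_W_has_fourier l c
           (\<lambda>g :: real ^ 'n ^ 'n.
              exp (- (\<i> * complex_of_real pi * (of_nat l + 1)\<^sup>2 / 4)) * cnj (feynman_W l c g))"
  unfolding feynman_W_has_fourier_def
proof (intro conjI allI impI)
  define K where "K = complex_of_real ((c / pi) powr (real l * (real l + 1) / 4))"
  define a where "a = (\<lambda>\<epsilon>. complex_of_real \<epsilon> + \<i> * of_real pi)"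
  have a: "Re (a \<epsilon>) > 0" if "\<epsilon> > 0" for \<epsilon> using that by (simp add: a_def)
  have reg: "exp (2 * complex_of_real pi * \<i> * of_real (trace (transpose g ** h))) * feynman_W_reg l c \<epsilon> g
      = K * (of_real (Delta_W g) * mat_wave (a \<epsilon>) h g)" for h g :: "real ^ 'n ^ 'n" and \<epsilon>
    by (simp add: feynman_W_reg_def K_def a_def mat_wave_def exp_add diff_conv_add_uminus
        del: add_uminus_conv_diff)
  show "integrable lborel (feynman_W_reg l c \<epsilon> :: real ^ 'n ^ 'n \<Rightarrow> complex)" if "\<epsilon> > 0" for \<epsilon>
  proof -
    \<comment> \<open>At frequency 0 the Fourier kernel is 1, so integrability of the density is a
      special case of that of the Fourier integrand.\<close>
    have "feynman_W_reg l c \<epsilon> = (\<lambda>g :: real ^ 'n ^ 'n. K * (of_real (Delta_W g) * mat_wave (a \<epsilon>) 0 g))"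
      using reg[of _ 0] by (simp add: fun_eq_iff trace_def)
    then show ?thesis by (simp add: integrable_Delta_W_mat_wave[OF a[OF that]])
  qed
  fix h :: "real ^ 'n ^ 'n"
  have fourier: "mat_fourier (feynman_W_reg l c \<epsilon>) h =
      K * (Delta_W_scaled (of_real pi * \<i> / a \<epsilon>) h * mat_wave_int (a \<epsilon>) h)" if "\<epsilon> > 0" for \<epsilon>
    unfolding mat_fourier_def reg
    by (simp add: integral_Delta_W_mat_wave[OF a[OF that]])
  have lim_a: "(a \<longlongrightarrow> \<i> * of_real pi) (at_right 0)"
    unfolding a_def by (auto intro!: tendsto_eq_intros)
  have nz: "csqrt (\<i> * of_real pi) \<noteq> 0" by simp
  \<comment> \<open>The limit point lies on the boundary of the half-plane of convergence but off
    the branch cut, so the closed form is continuous there.\<close>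
  have "isCont csqrt (\<i> * of_real pi)"
    by (rule continuous_at_csqrt) (auto simp: complex_nonpos_Reals_iff)
  then have lim_csqrt: "((\<lambda>\<epsilon>. csqrt (a \<epsilon>)) \<longlongrightarrow> csqrt (\<i> * of_real pi)) (at_right 0)"
    using lim_a by (rule isCont_tendsto_compose)
  have "((\<lambda>\<epsilon>. K * (Delta_W_scaled (of_real pi * \<i> / a \<epsilon>) h * mat_wave_int (a \<epsilon>) h)) \<longlongrightarrow>
     K * (Delta_W_scaled (of_real pi * \<i> / (\<i> * of_real pi)) h * mat_wave_int (\<i> * of_real pi) h)) (at_right 0)"
    unfolding Delta_W_scaled_def mat_wave_int_def
    by (intro tendsto_intros lim_a lim_csqrt nz) auto
  \<comment> \<open>The closed form equals the Fourier integral only for positive \<epsilon>, which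
    is all that the right-sided limit sees.\<close>
  moreover have "eventually (\<lambda>\<epsilon>. K * (Delta_W_scaled (of_real pi * \<i> / a \<epsilon>) h * mat_wave_int (a \<epsilon>) h) =
      mat_fourier (feynman_W_reg l c \<epsilon>) h) (at_right 0)"
    using eventually_at_right_less[of 0] by eventually_elim (simp add: fourier)
  ultimately have lim: "((\<lambda>\<epsilon>. mat_fourier (feynman_W_reg l c \<epsilon>) h) \<longlongrightarrow>
     K * (Delta_W_scaled (of_real pi * \<i> / (\<i> * of_real pi)) h * mat_wave_int (\<i> * of_real pi) h)) (at_right 0)"
    by (rule Lim_transform_eventually)
  have Delta: "Delta_W_scaled (of_real pi * \<i> / (\<i> * of_real pi)) h = of_real (Delta_W h)"
    by (simp add: Delta_W_scaled_def Delta_W_def)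
  have "of_real (sqrt pi) / csqrt (\<i> * of_real pi) = exp (- (\<i> * of_real pi / 4))"
    by (simp add: csqrt_ii_pi exp_minus field_simps)
  then have "(of_real (sqrt pi) / csqrt (\<i> * of_real pi)) ^ (CARD('n)\<^sup>2) =
      exp (- (\<i> * complex_of_real pi * (of_nat l + 1)\<^sup>2 / 4))"
    by (simp add: assms(1) algebra_simps flip: exp_of_nat_mult)
  \<comment> \<open>Dividing \<open>- pi^2\<close> by \<open>i * pi\<close> gives
    \<open>i * pi\<close>: the Gaussian exponent returns with the opposite sign, which is the
    complex conjugation in the claim.\<close>
  moreover have "- of_real (pi\<^sup>2 * trace (transpose h ** h)) / (\<i> * of_real pi) =
      \<i> * complex_of_real pi * of_real (trace (transpose h ** h))"
    by (simp add: field_simps power2_eq_square)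
  ultimately have int: "mat_wave_int (\<i> * of_real pi) h =
      exp (- (\<i> * complex_of_real pi * (of_nat l + 1)\<^sup>2 / 4)) *
      exp (\<i> * complex_of_real pi * of_real (trace (transpose h ** h)))"
    unfolding mat_wave_int_def by simp
  show "((\<lambda>\<epsilon>. mat_fourier (feynman_W_reg l c \<epsilon>) h) \<longlongrightarrow>
     exp (- (\<i> * complex_of_real pi * (of_nat l + 1)\<^sup>2 / 4)) * cnj (feynman_W l c h)) (at_right 0)"
    \<comment> \<open>\<open>K\<close> and \<open>Delta_W h\<close> are real, so conjugation affects
      only the exponential.\<close>
    using lim unfolding Delta int
    by (simp add: feynman_W_def K_def exp_cnj mult_ac)
qed

end
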